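(* Let $G$ be a finite non-solvable group. Then $G$ admits an irredundant generating set $\{a_1,\ldots,a_d\}$ with $$|a_1|,\ldots,|a_d|,\ |a_2a_1^{-1}|,\ldots,|a_d a_{d-1}^{-1}|>2.$$ In particular, $G$ admits an oriented regular representation (ORR).
   Context: $|g|$ denotes the order of $g$. A generating set $S$ of $G$ is irredundant if for every $s\in S$ the set $S\setminus\{s\}$ does not generate $G$. For a subset $S\subseteq G$, the Cayley digraph $\mathrm{Cay}(G,S)$ has vertex set $G$, and $(x,y)$ is an arc iff $yx^{-1}\in S$; $G$ acts on it by right multiplication. $G$ admits an ORR if there is a subset $S\subseteq G$ with $S\cap S^{-1}=\emptyset$ such that the full automorphism group of $\mathrm{Cay}(G,S)$ equals (the right regular representation of) $G$. *)

theory Defs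
  imports
    "HOL-Algebra.Algebra"
    "Graph_Theory.Pair_Digraph"
begin

definition irredundant_generating_set :: "('a, 'b) monoid_scheme \<Rightarrow> 'a set \<Rightarrow> bool" where
  "irredundant_generating_set G S \<longleftrightarrow>
     S \<subseteq> carrier G \<and> generate G S = carrier G \<and>
     (\<forall>s\<in>S. generate G (S - {s}) \<noteq> carrier G)"

definition cayley_digraph :: "('a, 'b) monoid_scheme \<Rightarrow> 'a set \<Rightarrow> 'a pair_pre_digraph" where
  "cayley_digraph G S =
     \<lparr> pverts = carrier G,
       parcs = {(x, y). x \<in> carrier G \<and> y \<in> carrier G \<and> y \<otimes>\<^bsub>G\<^esub> inv\<^bsub>G\<^esub> x \<in> S} \<rparr>"

text \<open>Permutations of a set are represented, as in \<^const>\<open>Bij\<close>, by functions that are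
  extensional on that set, so that distinct functions are distinct permutations.\<close>

definition digraph_automorphisms :: "'a pair_pre_digraph \<Rightarrow> ('a \<Rightarrow> 'a) set" where
  "digraph_automorphisms D =
     {f \<in> Bij (pverts D). \<forall>x\<in>pverts D. \<forall>y\<in>pverts D. (f x, f y) \<in> parcs D \<longleftrightarrow> (x, y) \<in> parcs D}"

definition right_regular_representation :: "('a, 'b) monoid_scheme \<Rightarrow> ('a \<Rightarrow> 'a) set" where
  "right_regular_representation G =
     (\<lambda>g. \<lambda>x\<in>carrier G. x \<otimes>\<^bsub>G\<^esub> g) ` carrier G"

definition admits_ORR :: "('a, 'b) monoid_scheme \<Rightarrow> bool" where
  "admits_ORR G \<longleftrightarrow>
     (\<exists>S \<subseteq> carrier G. S \<inter> set_inv\<^bsub>G\<^esub> S = {} \<and>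
        digraph_automorphisms (cayley_digraph G S) = right_regular_representation G)"

end

theory Submission
  imports Defs
begin

text \<open>
  Let \<open>R\<close> be a maximal solvable normal subgroup of \<open>G\<close>. In \<open>G/R\<close> no non-trivial cyclic subgroup
  is normal, so no non-trivial element is centralised or inverted by every element. Take a
  generating tuple of minimal length and improve it one entry at a time. If \<open>x\<close> is the last improved
  entry, \<open>c\<close> the next one and \<open>L\<close> the subgroup generated by all entries but \<open>c\<close>, then \<open>c\<close> may be
  replaced by any \<open>y \<in> c L\<close> or its inverse. Some such \<open>y\<close> neither centralises nor inverts
  \<open>x\<^sup>2\<close> modulo \<open>R\<close>; exchanging \<open>y\<close> for \<open>y x\<close> or \<open>y\<^sup>-\<^sup>1\<close> if necessary, \<open>y\<close> and \<open>y x\<^sup>-\<^sup>1\<close> have order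
  greater than 2.

  For the tuple \<open>a\<^sub>1, \<dots>, a\<^sub>d\<close> so obtained let \<open>b\<^sub>i = a\<^sub>i\<^sub>+\<^sub>1 a\<^sub>i\<^sup>-\<^sup>1\<close> and
  \<open>S = {a\<^sub>1, \<dots>, a\<^sub>d, b\<^sub>1, \<dots>, b\<^sub>d\<^sub>-\<^sub>1}\<close>. The only relations \<open>r s = t\<close> in \<open>S\<close> are \<open>b\<^sub>i a\<^sub>i = a\<^sub>i\<^sub>+\<^sub>1\<close>, so
  the out-neighbours of a vertex induce the directed path \<open>a\<^sub>1 \<rightarrow> \<dots> \<rightarrow> a\<^sub>d\<close> together with isolated
  vertices. Hence an automorphism fixing a vertex fixes the neighbours labelled \<open>a\<^sub>i\<close>, and therefore
  everything.
\<close>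

section \<open>Elements fixed or inverted under conjugation\<close>

lemma (in group) inv_mult_cancel:
  assumes "g \<in> carrier G" and "y \<in> carrier G"
  shows "inv g \<otimes> (g \<otimes> y) = y" and "g \<otimes> (inv g \<otimes> y) = y"
  using assms by (simp_all add: m_assoc[symmetric])

text \<open>For fixed \<open>y\<close> this says that \<open>g\<close> stabilises the set
  \<open>{y, inv y}\<close> under conjugation, which is why the \<open>g\<close> satisfying it form
  a subgroup.\<close>

definition (in group) conj_fixes_or_inverts :: "'a \<Rightarrow> 'a \<Rightarrow> bool" where
  "conj_fixes_or_inverts g y \<longleftrightarrow> g \<otimes> y \<otimes> inv g = y \<or> g \<otimes> y \<otimes> inv g = inv y"

lemma (in group) subgroup_conj_fixes_or_inverts:
  assumes y: "y \<in> carrier G"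
  shows "subgroup {g \<in> carrier G. conj_fixes_or_inverts g y} G"
proof (rule subgroupI)
  show "{g \<in> carrier G. conj_fixes_or_inverts g y} \<noteq> {}"
    using y by (auto simp: conj_fixes_or_inverts_def intro!: exI[of _ \<one>])
next
  fix g assume "g \<in> {g \<in> carrier G. conj_fixes_or_inverts g y}"
  then have g: "g \<in> carrier G" and c: "g \<otimes> y \<otimes> inv g = y \<or> g \<otimes> y \<otimes> inv g = inv y"
    by (auto simp: conj_fixes_or_inverts_def)
  have "inv g \<otimes> y \<otimes> g = y \<or> inv g \<otimes> y \<otimes> g = inv y"
    using c
  proof
    assume h: "g \<otimes> y \<otimes> inv g = y"
    have "inv g \<otimes> y \<otimes> g = inv g \<otimes> (g \<otimes> y \<otimes> inv g) \<otimes> g" by (simp only: h)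
    also have "\<dots> = y" using g y by (simp add: m_assoc inv_mult_cancel)
    finally show ?thesis by simp
  next
    assume h: "g \<otimes> y \<otimes> inv g = inv y"
    have "inv g \<otimes> y \<otimes> g = inv (inv g \<otimes> inv y \<otimes> g)" 
      using g y by (simp add: inv_mult_group m_assoc)
    also have "\<dots> = inv (inv g \<otimes> (g \<otimes> y \<otimes> inv g) \<otimes> g)" by (simp only: h)
    also have "\<dots> = inv y" using g y by (simp add: m_assoc inv_mult_cancel)
    finally show ?thesis by simp
  qed
  with g show "inv g \<in> {g \<in> carrier G. conj_fixes_or_inverts g y}"
    by (auto simp: conj_fixes_or_inverts_def)
next
  fix g h assume "g \<in> {g \<in> carrier G. conj_fixes_or_inverts g y}"
    and "h \<in> {g \<in> carrier G. conj_fixes_or_inverts g y}"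
  then have g: "g \<in> carrier G" and cg: "g \<otimes> y \<otimes> inv g = y \<or> g \<otimes> y \<otimes> inv g = inv y"
    and h: "h \<in> carrier G" and ch: "h \<otimes> y \<otimes> inv h = y \<or> h \<otimes> y \<otimes> inv h = inv y"
    by (auto simp: conj_fixes_or_inverts_def)
  have gi: "g \<otimes> inv y \<otimes> inv g = inv (g \<otimes> y \<otimes> inv g)"
    using g y by (simp add: inv_mult_group m_assoc)
  have "(g \<otimes> h) \<otimes> y \<otimes> inv (g \<otimes> h) = g \<otimes> (h \<otimes> y \<otimes> inv h) \<otimes> inv g"
    using g h y by (simp add: inv_mult_group m_assoc)
  then show "g \<otimes> h \<in> {g \<in> carrier G. conj_fixes_or_inverts g y}"
    using cg ch g h y gi by (auto simp: conj_fixes_or_inverts_def)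
qed auto

section \<open>The quotient by a maximal solvable normal subgroup\<close>

lemma (in group) solvable_seq_cyclic:
  assumes "y \<in> carrier G"
  shows "solvable_seq G (generate G {y})"
proof (rule augment_solvable_seq)
  show "subgroup (generate G {y}) G"
    using assms by (intro generate_is_subgroup) auto
  have comm: "u \<otimes> v = v \<otimes> u" if "u \<in> generate G {y}" "v \<in> generate G {y}" for u v
    using that assms by (auto simp: generate_pow int_pow_mult[symmetric] add.commute)
  have "u \<otimes> v \<otimes> inv u \<otimes> inv v = \<one>" if "u \<in> generate G {y}" "v \<in> generate G {y}" for u v
  proof -
    have "u \<in> carrier G" "v \<in> carrier G"
      using that assms generate_in_carrier[of "{y}"] by auto
    then show ?thesis
      using comm[OF that] by (simp add: m_assoc inv_mult_group[symmetric])
  qed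
  then have "derived_set G (generate G {y}) = {\<one>}"
    using generate.one[of G "{y}"] by auto
  then have "derived G (generate G {y}) = {\<one>}"
    by (simp add: derived_def generate_one)
  then show "solvable_seq G (derived G (generate G {y}))"
    by (simp add: solvable_seq.unity)
qed

text \<open>Take \<open>R\<close> of largest cardinality among the solvable normal subgroups. If
  \<open>y\<close> is fixed or inverted by every element of the quotient, the cyclic group it
  generates is normal there. Its preimage in \<open>G\<close> is normal and is solvable as an
  extension of \<open>R\<close> by a cyclic group, so it equals \<open>R\<close> and
  \<open>y\<close> is trivial.\<close>

lemma (in group) exists_quotient_without_inverted_elements:
  assumes fin: "finite (carrier G)" and ns: "\<not> solvable G"
  obtains R where "R \<lhd> G" and "R \<noteq> carrier G"
    and "\<And>y. y \<in> carrier (G Mod R) \<Longrightarrow>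
      (\<And>g. g \<in> carrier (G Mod R) \<Longrightarrow> group.conj_fixes_or_inverts (G Mod R) g y) \<Longrightarrow>
      y = \<one>\<^bsub>G Mod R\<^esub>"
proof -
  let ?P = "\<lambda>N. N \<lhd> G \<and> solvable_seq G N"
  have sub: "N \<subseteq> carrier G" if "?P N" for N
    using that normal_imp_subgroup subgroup.subset by blast
  have "?P {\<one>}" by (simp add: one_is_normal solvable_seq.unity)
  moreover have "\<forall>N. ?P N \<longrightarrow> card N < Suc (card (carrier G))"
    using sub card_mono[OF fin] by (simp add: less_Suc_eq_le)
  ultimately obtain R where R: "?P R" and max: "\<And>N. ?P N \<Longrightarrow> card N \<le> card R"
    using ex_has_greatest_nat[of ?P "{\<one>}" card "Suc (card (carrier G))"] by auto
  interpret R: normal R G using R by blast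
  interpret Q: group "G Mod R" by (rule R.factorgroup_is_group)
  let ?h = "\<lambda>g. R #> g"
  interpret h: group_hom G "G Mod R" ?h
    using R.r_coset_hom_Mod by unfold_locales
  have "y = \<one>\<^bsub>G Mod R\<^esub>"
    if y: "y \<in> carrier (G Mod R)"
      and inv: "\<And>g. g \<in> carrier (G Mod R) \<Longrightarrow> Q.conj_fixes_or_inverts g y" for y
  proof -
    let ?C = "generate (G Mod R) {y}"
    let ?J = "{g \<in> carrier G. ?h g \<in> ?C}"
    have C: "subgroup ?C (G Mod R)" using y by (intro Q.generate_is_subgroup) auto
    have y': "y \<in> ?C" by (simp add: generate.incl)
    have iy: "inv\<^bsub>G Mod R\<^esub> y \<in> carrier (G Mod R)" using y by simp
    \<comment> \<open>\<open>normal_generateI\<close> needs generators closed under conjugation;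
      \<open>{y}\<close> alone may fail this, since \<open>y\<close> may be sent to its
      inverse.\<close>
    have C_eq: "generate (G Mod R) {y, inv\<^bsub>G Mod R\<^esub> y} = ?C"
    proof
      show "generate (G Mod R) {y, inv\<^bsub>G Mod R\<^esub> y} \<subseteq> ?C"
        using C y' by (intro Q.generate_subgroup_incl) (auto intro: generate.inv)
    qed (intro Q.mono_generate, auto)
    have "generate (G Mod R) {y, inv\<^bsub>G Mod R\<^esub> y} \<lhd> (G Mod R)"
    proof (rule Q.normal_generateI)
      fix z g assume z: "z \<in> {y, inv\<^bsub>G Mod R\<^esub> y}" and g: "g \<in> carrier (G Mod R)"
      have "g \<otimes>\<^bsub>G Mod R\<^esub> inv\<^bsub>G Mod R\<^esub> y \<otimes>\<^bsub>G Mod R\<^esub> inv\<^bsub>G Mod R\<^esub> g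
          = inv\<^bsub>G Mod R\<^esub> (g \<otimes>\<^bsub>G Mod R\<^esub> y \<otimes>\<^bsub>G Mod R\<^esub> inv\<^bsub>G Mod R\<^esub> g)"
        using g y by (simp only: Q.inv_mult_group Q.m_assoc Q.inv_closed Q.m_closed Q.inv_inv)
      with inv[OF g] z y
      show "g \<otimes>\<^bsub>G Mod R\<^esub> z \<otimes>\<^bsub>G Mod R\<^esub> inv\<^bsub>G Mod R\<^esub> g \<in> {y, inv\<^bsub>G Mod R\<^esub> y}"
        unfolding Q.conj_fixes_or_inverts_def using Q.inv_inv[OF y] by auto
    qed (use y iy in auto)
    then have Cn: "?C \<lhd> (G Mod R)" by (simp only: C_eq)
    interpret C: normal ?C "G Mod R" by (rule Cn)
    have J: "subgroup ?J G"
    proof (rule subgroupI)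
      show "?J \<noteq> {}" using C.one_closed h.hom_one by (metis (mono_tags, lifting) empty_iff mem_Collect_eq one_closed)
    next
      fix a assume "a \<in> ?J" then show "inv a \<in> ?J"
        using C.m_inv_closed h.hom_inv by fastforce
    next
      fix a b assume "a \<in> ?J" "b \<in> ?J" then show "a \<otimes> b \<in> ?J"
        using C.m_closed h.hom_mult by fastforce
    qed auto
    have "?J \<lhd> G"
    proof (rule normal_invI[OF J])
      fix x a assume x: "x \<in> carrier G" and a: "a \<in> ?J"
      have "?h (x \<otimes> a \<otimes> inv x)
          = ?h x \<otimes>\<^bsub>G Mod R\<^esub> ?h a \<otimes>\<^bsub>G Mod R\<^esub> inv\<^bsub>G Mod R\<^esub> ?h x"
        using x a by (simp only: h.hom_mult h.hom_inv m_closed inv_closed mem_Collect_eq)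
      also have "\<dots> \<in> ?C" using x a by (intro C.inv_op_closed2 h.hom_closed) auto
      finally show "x \<otimes> a \<otimes> inv x \<in> ?J" using x a by auto
    qed
    \<comment> \<open>Restricted to \<open>?J\<close>, the projection \<open>?h\<close> has kernel
      \<open>R\<close> and cyclic image \<open>?C\<close>, both solvable.\<close>
    moreover have "solvable_seq G ?J"
    proof (rule solvable_seq_condition[of G G "\<lambda>g. g" "G Mod R" ?h R ?J])
      show "group_hom G G (\<lambda>g. g)" by unfold_locales (auto simp: hom_def)
      have RJ: "?h r = \<one>\<^bsub>G Mod R\<^esub>" if "r \<in> R" for r
        using that R.subset coset_join2[of r R] R.subgroup_axioms by auto
      then show "(\<lambda>g. g) ` R \<subseteq> ?J" using C.one_closed R.subset by auto
      show "kernel G (G Mod R) ?h \<subseteq> (\<lambda>g. g) ` R"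
        using R.subset coset_join1[of R] R.subgroup_axioms by (auto simp: kernel_def)
      have "?h ` ?J = ?C"
        using C.subset by (auto simp: carrier_FactGroup)
      then show "solvable_seq (G Mod R) (?h ` ?J)"
        using Q.solvable_seq_cyclic[OF y] by simp
    qed (use R J h.group_hom_axioms in auto)
    ultimately have "card ?J \<le> card R" using max by blast
    moreover have "R \<subseteq> ?J"
      using C.one_closed R.subset coset_join2[of _ R] R.subgroup_axioms by auto
    ultimately have JR: "?J = R"
      using card_seteq[of ?J R] fin by auto
    obtain g where g: "g \<in> carrier G" "y = ?h g" using y by (auto simp: carrier_FactGroup)
    then have "g \<in> R" using JR y' by auto
    then show ?thesis using g coset_join2[of g R] R.subgroup_axioms by simp
  qed
  moreover have "R \<noteq> carrier G" using R ns by (auto simp: solvable_def)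
  ultimately show thesis using that R by blast
qed


section \<open>Generic pairs and their existence in a coset\<close>

lemma (in group) conj_square:
  assumes "x \<in> carrier G" and "y \<in> carrier G"
  shows "y \<otimes> (x \<otimes> x) \<otimes> inv y = (y \<otimes> x \<otimes> inv y) \<otimes> (y \<otimes> x \<otimes> inv y)"
  using assms by (simp add: m_assoc inv_mult_cancel)

lemma (in group) inverts_imp_inverts_square:
  assumes "x \<in> carrier G" and "y \<in> carrier G" and "y \<otimes> x \<otimes> inv y = inv x"
  shows "conj_fixes_or_inverts y (x \<otimes> x)"
  using assms by (simp add: conj_fixes_or_inverts_def conj_square inv_mult_group)

lemma (in group) square_eq_one_iff:
  assumes "x \<in> carrier G" and "y \<in> carrier G"
  shows "(y \<otimes> x) \<otimes> (y \<otimes> x) = \<one> \<longleftrightarrow> y \<otimes> x \<otimes> y = inv x"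
proof -
  have "(y \<otimes> x) \<otimes> (y \<otimes> x) = (y \<otimes> x \<otimes> y) \<otimes> x" using assms by (simp add: m_assoc)
  then show ?thesis using assms inv_equality[of "y \<otimes> x \<otimes> y" x] l_inv[of x]
    by (metis m_closed)
qed

text \<open>For consecutive entries \<open>x\<close>, \<open>y\<close> of the tuple, the first three
  inequations rule out unwanted relations in the connection set that irredundancy alone does not
  exclude. The last one says that \<open>y (inv x)\<close> is neither trivial nor an
  involution.\<close>

definition (in group) generic_pair :: "'a \<Rightarrow> 'a \<Rightarrow> bool" where
  "generic_pair x y \<longleftrightarrow> x \<otimes> y \<noteq> y \<otimes> x \<and> x \<otimes> x \<noteq> y \<otimes> y \<and> x \<otimes> y \<otimes> x \<noteq> y \<and>
     (y \<otimes> inv x) \<otimes> (y \<otimes> inv x) \<noteq> \<one>"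

text \<open>Each of the first three relations, if it held, would make \<open>y\<close> fix or invert
  \<open>x x\<close>: commuting with \<open>x\<close> fixes it, \<open>x x = y y\<close> commutes
  with \<open>y\<close>, and \<open>x y x = y\<close> means that \<open>y\<close> inverts
  \<open>x\<close>.\<close>

lemma (in group) generic_pairI:
  assumes x: "x \<in> carrier G" and y: "y \<in> carrier G"
    and ncfi: "\<not> conj_fixes_or_inverts y (x \<otimes> x)"
    and sq: "(y \<otimes> inv x) \<otimes> (y \<otimes> inv x) \<noteq> \<one>"
  shows "generic_pair x y"
  unfolding generic_pair_def
proof (intro conjI notI)
  assume h: "x \<otimes> y = y \<otimes> x"
  have "y \<otimes> x \<otimes> inv y = x" using x y by (simp add: h[symmetric] m_assoc)
  then show False using ncfi x y by (simp add: conj_fixes_or_inverts_def conj_square)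
next
  assume "x \<otimes> x = y \<otimes> y"
  then have "y \<otimes> (x \<otimes> x) \<otimes> inv y = x \<otimes> x" using y by (simp add: m_assoc)
  then show False using ncfi by (simp add: conj_fixes_or_inverts_def)
next
  assume "x \<otimes> y \<otimes> x = y"
  then have "inv x \<otimes> y = y \<otimes> x" using x y by (metis inv_mult_cancel(1) m_assoc m_closed)
  then have "y \<otimes> x \<otimes> inv y = inv x" using x y by (metis inv_closed inv_solve_right' m_closed)
  then show False using ncfi inverts_imp_inverts_square x y by blast
qed (use sq in auto)

text \<open>The assumptions give \<open>y x y = inv x\<close> and
  \<open>(inv y) x (inv y) = inv x\<close>. In the product of the two left-hand sides the inner
  \<open>y\<close> cancels, leaving the conjugate of \<open>x x\<close> by \<open>y\<close>.\<close>

lemma (in group) squares_eq_one_imp_inverts_square: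
  assumes x: "x \<in> carrier G" and y: "y \<in> carrier G"
    and 1: "(y \<otimes> inv x) \<otimes> (y \<otimes> inv x) = \<one>" and 2: "(y \<otimes> x) \<otimes> (y \<otimes> x) = \<one>"
  shows "conj_fixes_or_inverts y (x \<otimes> x)"
proof -
  have e1: "y \<otimes> inv x \<otimes> y = x" using 1 square_eq_one_iff[of "inv x" y] x y by simp
  have e2: "y \<otimes> x \<otimes> y = inv x" using 2 square_eq_one_iff[of x y] x y by simp
  have "inv y \<otimes> x \<otimes> inv y = inv (y \<otimes> inv x \<otimes> y)"
    using x y by (simp add: inv_mult_group m_assoc)
  then have e3: "inv y \<otimes> x \<otimes> inv y = inv x" by (simp only: e1)
  have "y \<otimes> (x \<otimes> x) \<otimes> inv y = (y \<otimes> x \<otimes> y) \<otimes> (inv y \<otimes> x \<otimes> inv y)"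
    using x y by (simp add: m_assoc inv_mult_cancel)
  also have "\<dots> = inv (x \<otimes> x)" using x by (simp only: e2 e3 inv_mult_group)
  finally show ?thesis by (simp add: conj_fixes_or_inverts_def)
qed

text \<open>If the whole coset \<open>c L\<close> stabilised \<open>{y, inv y}\<close>, the
  stabiliser would contain \<open>c\<close> and \<open>L\<close>, hence the whole group, and
  \<open>y\<close> would be trivial.\<close>

lemma (in group) exists_nonnormalizing:
  assumes no_inverted: "\<And>y. y \<in> carrier G \<Longrightarrow>
      (\<And>g. g \<in> carrier G \<Longrightarrow> conj_fixes_or_inverts g y) \<Longrightarrow> y = \<one>"
    and L: "subgroup L G" and c: "c \<in> carrier G"
    and gen: "generate G (insert c L) = carrier G"
    and y: "y \<in> carrier G" "y \<noteq> \<one>"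
  shows "\<exists>l\<in>L. \<not> conj_fixes_or_inverts (c \<otimes> l) y"
proof (rule ccontr)
  assume "\<not> ?thesis"
  then have all: "conj_fixes_or_inverts (c \<otimes> l) y" if "l \<in> L" for l using that by blast
  define K where "K = {g \<in> carrier G. conj_fixes_or_inverts g y}"
  interpret L: subgroup L G by (rule L)
  have K: "subgroup K G" unfolding K_def by (rule subgroup_conj_fixes_or_inverts[OF y(1)])
  have cK: "c \<in> K" using all[OF L.one_closed] c by (simp add: K_def)
  have "l \<in> K" if l: "l \<in> L" for l
  proof -
    have "c \<otimes> l \<in> K" using all[OF l] c l by (simp add: K_def)
    then have "inv c \<otimes> (c \<otimes> l) \<in> K" using cK subgroup.m_closed[OF K] subgroup.m_inv_closed[OF K] by blast
    then show ?thesis using c l by (simp add: inv_mult_cancel)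
  qed
  then have "generate G (insert c L) \<subseteq> K"
    using cK by (intro generate_subgroup_incl[OF _ K]) auto
  then show False using gen no_inverted[OF y(1)] y(2) unfolding K_def by blast
qed

text \<open>Needed for the first entry, which has no predecessor. If every element of
  \<open>c L\<close> had square one, \<open>c\<close> would invert all of \<open>L\<close>, so
  \<open>L\<close> would be abelian. Then every \<open>c m\<close> with \<open>m\<close> in
  \<open>L\<close> would invert every element of \<open>L\<close>, which forces \<open>L\<close> and
  then \<open>c\<close> to be trivial.\<close>

lemma (in group) exists_non_involution:
  assumes no_inverted: "\<And>y. y \<in> carrier G \<Longrightarrow>
      (\<And>g. g \<in> carrier G \<Longrightarrow> conj_fixes_or_inverts g y) \<Longrightarrow> y = \<one>"
    and L: "subgroup L G" and c: "c \<in> carrier G"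
    and gen: "generate G (insert c L) = carrier G"
    and nontriv: "carrier G \<noteq> {\<one>}"
  shows "\<exists>l\<in>L. (c \<otimes> l) \<otimes> (c \<otimes> l) \<noteq> \<one>"
proof (rule ccontr)
  assume "\<not> ?thesis"
  then have all: "(c \<otimes> l) \<otimes> (c \<otimes> l) = \<one>" if "l \<in> L" for l using that by blast
  interpret L: subgroup L G by (rule L)
  have cc: "inv c = c" using all[OF L.one_closed] c by (simp add: inv_equality)
  have clc: "c \<otimes> l \<otimes> c = inv l" if "l \<in> L" for l
    using all[OF that] square_eq_one_iff[of l c] c that by simp
  have comm: "l \<otimes> m = m \<otimes> l" if l: "l \<in> L" and m: "m \<in> L" for l m
  proof -
    have "inv (m \<otimes> l) = c \<otimes> (m \<otimes> l) \<otimes> c" using clc[of "m \<otimes> l"] l m by simp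
    also have "\<dots> = c \<otimes> m \<otimes> (c \<otimes> inv c) \<otimes> l \<otimes> c" using c l m by (simp add: m_assoc)
    also have "\<dots> = (c \<otimes> m \<otimes> c) \<otimes> (c \<otimes> l \<otimes> c)" using c l m by (simp add: cc m_assoc)
    also have "\<dots> = inv (l \<otimes> m)" using clc l m by (simp add: inv_mult_group)
    finally show ?thesis using l m by (metis L.mem_carrier inv_inv m_closed)
  qed
  have L1: "l = \<one>" if l: "l \<in> L" for l
  proof (rule ccontr)
    assume "l \<noteq> \<one>"
    then obtain m where m: "m \<in> L" "\<not> conj_fixes_or_inverts (c \<otimes> m) l"
      using exists_nonnormalizing[OF no_inverted L c gen, of l] l by auto
    have "(c \<otimes> m) \<otimes> l \<otimes> inv (c \<otimes> m) = c \<otimes> (m \<otimes> l \<otimes> inv m) \<otimes> c"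
      using c l m by (simp add: inv_mult_group m_assoc cc)
    also have "m \<otimes> l \<otimes> inv m = l" using comm[OF m(1) l] m l by (simp add: m_assoc)
    finally show False using m(2) clc[OF l] by (simp add: conj_fixes_or_inverts_def)
  qed
  have "c = \<one>"
  proof (rule ccontr)
    assume "c \<noteq> \<one>"
    then obtain m where "m \<in> L" "\<not> conj_fixes_or_inverts (c \<otimes> m) c"
      using exists_nonnormalizing[OF no_inverted L c gen, of c] c by auto
    then show False using L1[of m] c by (simp add: conj_fixes_or_inverts_def m_assoc)
  qed
  with L1 have "generate G (insert c L) \<subseteq> {\<one>}"
    by (intro generate_subgroup_incl[OF _ triv_subgroup]) auto
  then show False using gen nontriv by auto
qed

lemma (in group) exists_generic_pair:
  assumes no_inverted: "\<And>y. y \<in> carrier G \<Longrightarrow>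
      (\<And>g. g \<in> carrier G \<Longrightarrow> conj_fixes_or_inverts g y) \<Longrightarrow> y = \<one>"
    and L: "subgroup L G" and c: "c \<in> carrier G"
    and gen: "generate G (insert c L) = carrier G"
    and x: "x \<in> L" "x \<otimes> x \<noteq> \<one>"
  shows "\<exists>l\<in>L. \<exists>y\<in>{c \<otimes> l, inv (c \<otimes> l)}. y \<otimes> y \<noteq> \<one> \<and> generic_pair x y"
proof -
  interpret L: subgroup L G by (rule L)
  have xc: "x \<in> carrier G" using x by simp
  define K where "K = {g \<in> carrier G. conj_fixes_or_inverts g (x \<otimes> x)}"
  have K: "subgroup K G"
    unfolding K_def by (rule subgroup_conj_fixes_or_inverts) (simp add: xc)
  have xK: "x \<in> K" using xc by (simp add: K_def conj_fixes_or_inverts_def m_assoc)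
  obtain m where m: "m \<in> L" "c \<otimes> m \<notin> K"
    using exists_nonnormalizing[OF no_inverted L c gen _ x(2)] xc unfolding K_def by auto
  obtain l where l: "l \<in> L" and lK: "c \<otimes> l \<notin> K" and lsq: "(c \<otimes> l) \<otimes> (c \<otimes> l) \<noteq> \<one>"
  proof (cases "(c \<otimes> m) \<otimes> (c \<otimes> m) = \<one>")
    case False
    then show thesis using that m by blast
  next
    \<comment> \<open>Replace \<open>?d\<close> by \<open>?d x\<close>: it stays outside
      \<open>K\<close> because \<open>x\<close> lies in \<open>K\<close>. If it had square one as
      well, \<open>?d\<close> would invert \<open>x\<close> and hence \<open>x x\<close>.\<close>
    case True
    let ?d = "c \<otimes> m"
    have d: "?d \<in> carrier G" using c m by simp
    have "?d \<otimes> x \<notin> K"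
    proof
      assume "?d \<otimes> x \<in> K"
      then have "?d \<otimes> x \<otimes> inv x \<in> K" using xK subgroup.m_closed[OF K] subgroup.m_inv_closed[OF K] by blast
      then show False using m(2) d xc by (simp add: m_assoc)
    qed
    moreover have "(?d \<otimes> x) \<otimes> (?d \<otimes> x) \<noteq> \<one>"
    proof
      assume "(?d \<otimes> x) \<otimes> (?d \<otimes> x) = \<one>"
      moreover have "inv ?d = ?d" using True d by (simp only: inv_equality)
      ultimately have "?d \<otimes> x \<otimes> inv ?d = inv x" using square_eq_one_iff[of x ?d] xc d by simp
      then show False using inverts_imp_inverts_square[OF xc d] m(2) d unfolding K_def by blast
    qed
    moreover have "?d \<otimes> x = c \<otimes> (m \<otimes> x)" using c m xc by (simp add: m_assoc)
    ultimately show thesis using that[of "m \<otimes> x"] m x by simp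
  qed
  let ?d = "c \<otimes> l"
  have d: "?d \<in> carrier G" using c l by simp
  show ?thesis
  proof (cases "(?d \<otimes> inv x) \<otimes> (?d \<otimes> inv x) = \<one>")
    case False
    then have "generic_pair x ?d" using generic_pairI[OF xc d] lK d unfolding K_def by blast
    then show ?thesis using l lsq by blast
  next
    case True
    \<comment> \<open>Here \<open>inv ?d\<close> is used instead of \<open>?d\<close>. If
      \<open>(inv ?d) (inv x)\<close> also had square one, so would \<open>?d x\<close>; together
      with \<open>True\<close> this would make \<open>?d\<close> invert \<open>x x\<close>.\<close>
    have "(?d \<otimes> x) \<otimes> (?d \<otimes> x) \<noteq> \<one>"
      using squares_eq_one_imp_inverts_square[OF xc d True] lK d unfolding K_def by blast
    moreover have "(?d \<otimes> x) \<otimes> (?d \<otimes> x) = \<one>"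
      if "(inv ?d \<otimes> inv x) \<otimes> (inv ?d \<otimes> inv x) = \<one>"
    proof -
      have "inv ?d \<otimes> inv x \<otimes> inv ?d = x"
        using that square_eq_one_iff[of "inv x" "inv ?d"] xc d by simp
      then have "inv (inv ?d \<otimes> inv x \<otimes> inv ?d) = inv x" by simp
      then have "?d \<otimes> x \<otimes> ?d = inv x"
        using xc d by (simp add: inv_mult_group[of _ "inv ?d"] inv_mult_group[of "inv ?d"] m_assoc del: inv_mult_group)
      then show ?thesis using square_eq_one_iff[of x ?d] xc d by simp
    qed
    ultimately have "(inv ?d \<otimes> inv x) \<otimes> (inv ?d \<otimes> inv x) \<noteq> \<one>" by blast
    moreover have "\<not> conj_fixes_or_inverts (inv ?d) (x \<otimes> x)"
    proof
      assume "conj_fixes_or_inverts (inv ?d) (x \<otimes> x)"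
      then have "inv ?d \<in> K" using d by (simp add: K_def)
      then have "inv (inv ?d) \<in> K" by (rule subgroup.m_inv_closed[OF K])
      then show False using lK d by simp
    qed
    ultimately have "generic_pair x (inv ?d)" using generic_pairI[OF xc] d by simp
    moreover have "inv ?d \<otimes> inv ?d \<noteq> \<one>"
      using lsq d by (metis inv_equality inv_inv r_inv inv_closed)
    ultimately show ?thesis using l by blast
  qed
qed

text \<open>Genericity consists of inequations only, so it can be achieved in the quotient and
  pulled back.\<close>

lemma (in group_hom) generic_pair_hom:
  assumes "x \<in> carrier G" "y \<in> carrier G" "H.generic_pair (h x) (h y)"
  shows "G.generic_pair x y"
proof -
  have *: "h x \<otimes>\<^bsub>H\<^esub> h y = h (x \<otimes> y)" "h y \<otimes>\<^bsub>H\<^esub> h x = h (y \<otimes> x)"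
    "h x \<otimes>\<^bsub>H\<^esub> h x = h (x \<otimes> x)" "h y \<otimes>\<^bsub>H\<^esub> h y = h (y \<otimes> y)"
    "h (x \<otimes> y) \<otimes>\<^bsub>H\<^esub> h x = h (x \<otimes> y \<otimes> x)"
    "h y \<otimes>\<^bsub>H\<^esub> inv\<^bsub>H\<^esub> h x = h (y \<otimes> inv x)"
    "h (y \<otimes> inv x) \<otimes>\<^bsub>H\<^esub> h (y \<otimes> inv x) = h ((y \<otimes> inv x) \<otimes> (y \<otimes> inv x))"
    "\<one>\<^bsub>H\<^esub> = h \<one>"
    using assms(1,2) by simp_all
  show ?thesis
    using assms(3) unfolding G.generic_pair_def H.generic_pair_def * by metis
qed

section \<open>Improving a generating tuple entry by entry\<close>

text \<open>The old entry is recovered as \<open>y\<close> or \<open>inv y\<close> times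
  \<open>inv l\<close>, where \<open>l\<close> comes from the untouched entries.\<close>

lemma (in group) generate_fun_upd:
  assumes a: "a ` I \<subseteq> carrier G" and j: "j \<in> I"
    and l: "l \<in> generate G (a ` (I - {j}))"
    and y: "y \<in> {a j \<otimes> l, inv (a j \<otimes> l)}"
    and gen: "generate G (a ` I) = carrier G"
  shows "generate G ((a(j := y)) ` I) = carrier G"
proof -
  let ?a = "a(j := y)" and ?L = "generate G (a ` (I - {j}))"
  have rest: "?a ` (I - {j}) = a ` (I - {j})" by auto
  have lc: "l \<in> carrier G" using l a generate_in_carrier[of "a ` (I - {j})" l] by blast
  have aj: "a j \<in> carrier G" using a j by blast
  have yc: "y \<in> carrier G" using y lc aj by auto
  have ac: "?a ` I \<subseteq> carrier G" using a yc by auto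
  interpret A: subgroup "generate G (?a ` I)" G by (rule generate_is_subgroup[OF ac])
  have "?L \<subseteq> generate G (?a ` I)"
    unfolding rest[symmetric] by (rule mono_generate) auto
  then have l': "l \<in> generate G (?a ` I)" using l by blast
  have "y \<in> generate G (?a ` I)" using j by (auto intro!: generate.incl)
  then have "a j \<otimes> l \<in> generate G (?a ` I)"
    using y A.m_inv_closed[of y] aj lc by auto
  then have "(a j \<otimes> l) \<otimes> inv l \<in> generate G (?a ` I)" using l' by blast
  then have "a j \<in> generate G (?a ` I)" using aj lc by (simp add: m_assoc)
  moreover have "a i \<in> generate G (?a ` I)" if "i \<in> I" "i \<noteq> j" for i
    using that by (auto intro!: generate.incl image_eqI[of _ _ i])
  ultimately have "a ` I \<subseteq> generate G (?a ` I)" by auto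
  then have "generate G (a ` I) \<subseteq> generate G (?a ` I)"
    using generate_subgroup_incl A.subgroup_axioms by blast
  then show ?thesis using gen A.subset by blast
qed

text \<open>The induction is on the number \<open>k\<close> of improved entries. Its invariant is
  stated in the quotient \<open>Q\<close>, where no nontrivial element is fixed or inverted by
  everything; only generation is tracked in \<open>G\<close>, and the inequations are lifted at the
  end. The length \<open>d\<close> is preserved, so minimality can be applied to the new
  tuple.\<close>

lemma (in group) exists_generic_tuple:
  fixes d :: nat
  assumes fin: "finite (carrier G)" and ns: "\<not> solvable G"
    and ex: "b ` {1..d} \<subseteq> carrier G" "generate G (b ` {1..d}) = carrier G"
  obtains a where "a ` {1..d} \<subseteq> carrier G" and "generate G (a ` {1..d}) = carrier G"
    and "\<And>i. i \<in> {1..d} \<Longrightarrow> a i \<otimes> a i \<noteq> \<one>"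
    and "\<And>i. i \<in> {1..<d} \<Longrightarrow> generic_pair (a i) (a (i + 1))"
proof -
  obtain R where R: "R \<lhd> G" "R \<noteq> carrier G" and no_inverted: "\<And>y. y \<in> carrier (G Mod R) \<Longrightarrow>
      (\<And>g. g \<in> carrier (G Mod R) \<Longrightarrow> group.conj_fixes_or_inverts (G Mod R) g y) \<Longrightarrow>
      y = \<one>\<^bsub>G Mod R\<^esub>"
    using exists_quotient_without_inverted_elements[OF fin ns] by blast
  interpret R: normal R G by (rule R)
  define Q where "Q = G Mod R"
  define h where "h = (\<lambda>g. R #> g)"
  interpret Q: group Q unfolding Q_def by (rule R.factorgroup_is_group)
  interpret h: group_hom G Q h
    unfolding Q_def h_def using R.r_coset_hom_Mod R.factorgroup_is_group
    by (intro group_hom.intro group_hom_axioms.intro is_group)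
  have surj: "h ` carrier G = carrier Q" by (simp add: Q_def h_def carrier_FactGroup)
  have nontriv: "carrier Q \<noteq> {\<one>\<^bsub>Q\<^esub>}"
  proof
    assume Q1: "carrier Q = {\<one>\<^bsub>Q\<^esub>}"
    have "g \<in> R" if "g \<in> carrier G" for g
      using that Q1 surj coset_join1[of R g] R.subset R.subgroup_axioms
      by (auto simp: Q_def h_def)
    then show False using R(2) R.subset by blast
  qed
  have "\<exists>a. a ` {1..d} \<subseteq> carrier G \<and> generate G (a ` {1..d}) = carrier G \<and>
      (\<forall>i\<in>{1..k}. h (a i) \<otimes>\<^bsub>Q\<^esub> h (a i) \<noteq> \<one>\<^bsub>Q\<^esub>) \<and>
      (\<forall>i\<in>{1..<k}. Q.generic_pair (h (a i)) (h (a (i + 1))))" if "k \<le> d" for k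
    using that
  proof (induction k)
    case 0
    then show ?case using ex by auto
  next
    case (Suc k)
    then obtain a where a: "a ` {1..d} \<subseteq> carrier G" "generate G (a ` {1..d}) = carrier G"
      and sq: "\<And>i. i \<in> {1..k} \<Longrightarrow> h (a i) \<otimes>\<^bsub>Q\<^esub> h (a i) \<noteq> \<one>\<^bsub>Q\<^esub>"
      and gp: "\<And>i. i \<in> {1..<k} \<Longrightarrow> Q.generic_pair (h (a i)) (h (a (i + 1)))"
      by auto
    let ?c = "a (Suc k)" and ?X = "a ` ({1..d} - {Suc k})"
    let ?L = "generate G ?X"
    have j: "Suc k \<in> {1..d}" using Suc.prems by simp
    have X: "?X \<subseteq> carrier G" using a(1) by blast
    have c: "?c \<in> carrier G" using a(1) j by blast
    have L: "subgroup ?L G" by (rule generate_is_subgroup[OF X])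
    have hL: "subgroup (h ` ?L) Q" by (rule h.subgroup_img_is_subgroup[OF L])
    have "insert (h ?c) (h ` ?L) \<subseteq> carrier Q" using c subgroup.subset[OF hL] by auto
    moreover have "h ` (a ` {1..d}) \<subseteq> insert (h ?c) (h ` ?L)"
      by (auto intro!: generate.incl)
    ultimately have "generate Q (h ` (a ` {1..d})) \<subseteq> generate Q (insert (h ?c) (h ` ?L))"
      by (intro Q.mono_generate)
    moreover have "generate Q (h ` (a ` {1..d})) = carrier Q"
      using h.generate_img[OF a(1)] a(2) surj by simp
    ultimately have gen: "generate Q (insert (h ?c) (h ` ?L)) = carrier Q"
      using Q.generate_incl[OF \<open>insert (h ?c) (h ` ?L) \<subseteq> carrier Q\<close>] by blast
    \<comment> \<open>For \<open>k = 0\<close> there is no preceding entry, and only the square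
      condition has to be met.\<close>
    have "\<exists>l\<in>h ` ?L. \<exists>y\<in>{h ?c \<otimes>\<^bsub>Q\<^esub> l, inv\<^bsub>Q\<^esub> (h ?c \<otimes>\<^bsub>Q\<^esub> l)}. y \<otimes>\<^bsub>Q\<^esub> y \<noteq> \<one>\<^bsub>Q\<^esub> \<and>
        (k \<noteq> 0 \<longrightarrow> Q.generic_pair (h (a k)) y)"
    proof (cases "k = 0")
      case True
      then show ?thesis
        using Q.exists_non_involution[OF no_inverted[folded Q_def] hL _ gen nontriv] c by auto
    next
      case False
      then have "a k \<in> ?L" using j by (auto intro!: generate.incl)
      then have "h (a k) \<in> h ` ?L" by blast
      moreover have "h (a k) \<otimes>\<^bsub>Q\<^esub> h (a k) \<noteq> \<one>\<^bsub>Q\<^esub>" using sq False by simp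
      ultimately show ?thesis
        using Q.exists_generic_pair[OF no_inverted[folded Q_def] hL h.hom_closed[OF c] gen]
        by blast
    qed
    then obtain l z where l: "l \<in> ?L"
      and z: "z \<in> {h ?c \<otimes>\<^bsub>Q\<^esub> h l, inv\<^bsub>Q\<^esub> (h ?c \<otimes>\<^bsub>Q\<^esub> h l)}" "z \<otimes>\<^bsub>Q\<^esub> z \<noteq> \<one>\<^bsub>Q\<^esub>"
        "k \<noteq> 0 \<longrightarrow> Q.generic_pair (h (a k)) z"
      by blast
    have lc: "l \<in> carrier G" using generate_in_carrier[OF X l] .
    \<comment> \<open>An arbitrary preimage of \<open>z\<close> might destroy generation; one of the
      form \<open>?c l\<close> or its inverse does not.\<close>
    have "z \<in> h ` {?c \<otimes> l, inv (?c \<otimes> l)}" using z(1) c lc by simp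
    then obtain y where zy: "z = h y" and y: "y \<in> {?c \<otimes> l, inv (?c \<otimes> l)}" by (rule imageE)
    let ?a = "a(Suc k := y)"
    have yc: "y \<in> carrier G" using y c lc by auto
    have "?a ` {1..d} \<subseteq> carrier G" using a(1) yc by auto
    moreover have "generate G (?a ` {1..d}) = carrier G"
      by (rule generate_fun_upd[OF a(1) j l y a(2)])
    moreover have "h (?a i) \<otimes>\<^bsub>Q\<^esub> h (?a i) \<noteq> \<one>\<^bsub>Q\<^esub>" if "i \<in> {1..Suc k}" for i
      using that sq[of i] z(2) zy by (cases "i = Suc k") auto
    moreover have "Q.generic_pair (h (?a i)) (h (?a (i + 1)))" if "i \<in> {1..<Suc k}" for i
      using that gp[of i] z(3) zy by (cases "i = k") auto
    ultimately show ?case by blast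
  qed
  from this[of d] obtain a where a: "a ` {1..d} \<subseteq> carrier G" "generate G (a ` {1..d}) = carrier G"
      and sq: "\<And>i. i \<in> {1..d} \<Longrightarrow> h (a i) \<otimes>\<^bsub>Q\<^esub> h (a i) \<noteq> \<one>\<^bsub>Q\<^esub>"
      and gp: "\<And>i. i \<in> {1..<d} \<Longrightarrow> Q.generic_pair (h (a i)) (h (a (i + 1)))"
    by auto
  have ac: "a i \<in> carrier G" if "i \<in> {1..d}" for i using that a(1) by blast
  show thesis
  proof (rule that[OF a])
    show "a i \<otimes> a i \<noteq> \<one>" if i: "i \<in> {1..d}" for i
      using sq[OF i] h.hom_mult[OF ac[OF i] ac[OF i]] by (metis h.hom_one)
    show "generic_pair (a i) (a (i + 1))" if "i \<in> {1..<d}" for i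
      using that by (intro h.generic_pair_hom gp ac) auto
  qed
qed

section \<open>Relations in the connection set of a generic tuple\<close>

locale generic_generating_tuple = group G for G (structure) +
  fixes a :: "nat \<Rightarrow> 'a" and d :: nat
  assumes closed: "i \<in> {1..d} \<Longrightarrow> a i \<in> carrier G"
    and generates: "generate G (a ` {1..d}) = carrier G"
    and irredundant: "i \<in> {1..d} \<Longrightarrow> a i \<notin> generate G (a ` ({1..d} - {i}))"
    and square: "i \<in> {1..d} \<Longrightarrow> a i \<otimes> a i \<noteq> \<one>"
    and generic: "i \<in> {1..<d} \<Longrightarrow> generic_pair (a i) (a (i + 1))"
begin

definition b :: "nat \<Rightarrow> 'a" where
  "b i = a (i + 1) \<otimes> inv (a i)"

definition S :: "'a set" where
  "S = a ` {1..d} \<union> b ` {1..<d}"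

text \<open>Non-membership in \<open>H j\<close> detects the index \<open>j\<close>: it is carried
  by \<open>a j\<close>, by \<open>b j\<close> and by \<open>b (j - 1)\<close> as far as these
  exist, and by no other element of \<open>S\<close>. In a relation \<open>r s = t\<close> no index
  is carried by exactly one factor.\<close>

definition H :: "nat \<Rightarrow> 'a set" where
  "H j = generate G (a ` ({1..d} - {j}))"

lemma subgroup_H: "subgroup (H j) G"
  unfolding H_def using closed by (intro generate_is_subgroup) auto

lemma b_closed: "i \<in> {1..<d} \<Longrightarrow> b i \<in> carrier G"
  by (simp add: b_def closed)

lemma S_closed: "s \<in> S \<Longrightarrow> s \<in> carrier G"
  using closed b_closed by (auto simp: S_def)

lemma b_mult: "i \<in> {1..<d} \<Longrightarrow> b i \<otimes> a i = a (i + 1)"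
  by (simp add: b_def closed m_assoc)

lemma a_in_H_iff: "i \<in> {1..d} \<Longrightarrow> j \<in> {1..d} \<Longrightarrow> a i \<in> H j \<longleftrightarrow> i \<noteq> j"
  using irredundant by (auto simp: H_def intro!: generate.incl)

text \<open>Any two of \<open>a i\<close>, \<open>a (i + 1)\<close>, \<open>b i\<close> generate the
  third, and at most one of \<open>a i\<close>, \<open>a (i + 1)\<close> lies outside
  \<open>H j\<close>.\<close>

lemma b_in_H_iff:
  assumes i: "i \<in> {1..<d}" and j: "j \<in> {1..d}"
  shows "b i \<in> H j \<longleftrightarrow> j \<noteq> i \<and> j \<noteq> i + 1"
proof -
  interpret H: subgroup "H j" G by (rule subgroup_H)
  have ai: "a i \<in> H j \<longleftrightarrow> i \<noteq> j" and aj: "a (i + 1) \<in> H j \<longleftrightarrow> i + 1 \<noteq> j"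
    using a_in_H_iff i j by auto
  have c: "a i \<in> carrier G" "a (i + 1) \<in> carrier G" "b i \<in> carrier G"
    using closed b_closed i by auto
  have "a (i + 1) \<in> H j" if "b i \<in> H j" "a i \<in> H j"
    using H.m_closed[OF that] b_mult[OF i] by simp
  moreover have "a i \<in> H j" if "b i \<in> H j" "a (i + 1) \<in> H j"
  proof -
    have "inv (b i) \<otimes> a (i + 1) \<in> H j" using that by blast
    then show ?thesis using b_mult[OF i] c by (metis inv_mult_cancel(1))
  qed
  moreover have "b i \<in> H j" if "a i \<in> H j" "a (i + 1) \<in> H j"
    using that by (auto simp: b_def)
  ultimately show ?thesis using ai aj by auto
qed

lemma mult_in_H:
  assumes "r \<in> carrier G" "s \<in> carrier G"
  shows "r \<in> H j \<Longrightarrow> s \<in> H j \<Longrightarrow> r \<otimes> s \<in> H j"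
    and "r \<in> H j \<Longrightarrow> r \<otimes> s \<in> H j \<Longrightarrow> s \<in> H j"
    and "s \<in> H j \<Longrightarrow> r \<otimes> s \<in> H j \<Longrightarrow> r \<in> H j"
proof -
  interpret H: subgroup "H j" G by (rule subgroup_H)
  show "r \<in> H j \<Longrightarrow> s \<in> H j \<Longrightarrow> r \<otimes> s \<in> H j" by simp
  show "s \<in> H j" if "r \<in> H j" "r \<otimes> s \<in> H j"
    using H.m_closed[OF H.m_inv_closed[OF that(1)] that(2)] assms by (simp add: inv_mult_cancel)
  show "r \<in> H j" if "s \<in> H j" "r \<otimes> s \<in> H j"
    using H.m_closed[OF that(2) H.m_inv_closed[OF that(1)]] assms by (simp add: m_assoc)
qed

lemma b_square: "i \<in> {1..<d} \<Longrightarrow> b i \<otimes> b i \<noteq> \<one>"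
  using generic[of i] by (simp add: generic_pair_def b_def)

lemma S_cases:
  assumes "s \<in> S"
  obtains (a) i where "i \<in> {1..d}" "s = a i" | (b) i where "i \<in> {1..<d}" "s = b i"
  using assms by (auto simp: S_def)

text \<open>Mutually inverse elements carry the same indices. An \<open>a i\<close> carries one
  index and a \<open>b i\<close> two consecutive ones, so the two elements coincide and would have
  square one.\<close>

lemma mult_S_neq_one:
  assumes r: "r \<in> S" and s: "s \<in> S"
  shows "r \<otimes> s \<noteq> \<one>"
proof
  assume rs: "r \<otimes> s = \<one>"
  have eq: "r \<in> H j \<longleftrightarrow> s \<in> H j" for j
    using mult_in_H(2,3)[OF r[THEN S_closed] s[THEN S_closed], of j]
      subgroup.one_closed[OF subgroup_H, of j] rs by auto
  from r show False
  proof (cases rule: S_cases)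
    case r: (a i)
    from s show False
    proof (cases rule: S_cases)
      case s: (a j)
      have "i = j" using eq[of i] r s by (simp add: a_in_H_iff)
      then show False using rs r s square by simp
    next
      case s: (b j)
      have "i = j" "i = j + 1"
        using eq[of j] eq[of "j + 1"] r s by (auto simp: a_in_H_iff b_in_H_iff)
      then show False by simp
    qed
  next
    case r: (b i)
    from s show False
    proof (cases rule: S_cases)
      case s: (a j)
      have "j = i" "j = i + 1"
        using eq[of i] eq[of "i + 1"] r s by (auto simp: a_in_H_iff b_in_H_iff)
      then show False by simp
    next
      case s: (b j)
      have "i = j" using eq[of i] eq[of "i + 1"] r s by (auto simp: b_in_H_iff)
      then show False using rs r s b_square by simp
    qed
  qed
qed

lemma not_commute: "i \<in> {1..<d} \<Longrightarrow> a i \<otimes> a (i + 1) \<noteq> a (i + 1) \<otimes> a i"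
  using generic[of i] by (simp add: generic_pair_def)

text \<open>An index that occurs in exactly one of the three factors of a relation \<open>r s = t\<close> could be
  eliminated, contradicting irredundancy; genericity excludes the few remaining relations.\<close>

lemma mult_S_in_S:
  assumes r: "r \<in> S" and s: "s \<in> S" and t: "r \<otimes> s \<in> S"
  shows "\<exists>i\<in>{1..<d}. s = a i \<and> r \<otimes> s = a (i + 1)"
proof -
  have rc: "r \<in> carrier G" and sc: "s \<in> carrier G" using r s S_closed by auto
  obtain t where t: "t \<in> S" and rst: "r \<otimes> s = t" using t by blast
  have el: "r \<in> H j \<Longrightarrow> s \<in> H j \<Longrightarrow> t \<in> H j" "r \<in> H j \<Longrightarrow> t \<in> H j \<Longrightarrow> s \<in> H j"
    "s \<in> H j \<Longrightarrow> t \<in> H j \<Longrightarrow> r \<in> H j" for j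
    using mult_in_H[OF rc sc, of j] rst by auto
  \<comment> \<open>Otherwise \<open>s\<close> or \<open>r\<close> would be the identity, whose
    square is the identity.\<close>
  have neq: "t \<noteq> r" "t \<noteq> s"
    using rst rc sc mult_S_neq_one[OF r r] mult_S_neq_one[OF s s]
    by (metis r_cancel_one l_cancel_one l_one)+
  from r show ?thesis
  proof (cases rule: S_cases)
    case r: (a i)
    from s show ?thesis
    proof (cases rule: S_cases)
      case s: (a j)
      from t show ?thesis
      proof (cases rule: S_cases)
        case t: (a k)
        have "k = i \<or> k = j"
          using el(1)[of k] r s t by (auto simp: a_in_H_iff)
        then show ?thesis using neq r s t by auto
      next
        case t: (b k)
        have "i = k \<or> j = k" "i = k + 1 \<or> j = k + 1"
          using el(1)[of k] el(1)[of "k + 1"] r s t by (auto simp: a_in_H_iff b_in_H_iff)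
        then have "i = k \<and> j = k + 1 \<or> i = k + 1 \<and> j = k" by auto
        then show ?thesis
        proof
          assume h: "i = k \<and> j = k + 1"
          have "a k \<otimes> a (k + 1) \<otimes> a k = a (k + 1)"
            using rst r s t h b_mult[of k] by simp
          then show ?thesis using generic[of k] t by (simp add: generic_pair_def)
        next
          assume h: "i = k + 1 \<and> j = k"
          then have "inv (a k) = a k"
            using rst r s t closed by (simp add: b_def)
          then show ?thesis using square[of k] closed[of k] s h by (metis r_inv)
        qed
      qed
    next
      case s: (b j)
      from t show ?thesis
      proof (cases rule: S_cases)
        case t: (a k)
        have "i = j \<or> k = j" "i = j + 1 \<or> k = j + 1"
          using el(2)[of j] el(2)[of "j + 1"] r s t by (auto simp: a_in_H_iff b_in_H_iff)
        then have "i = j \<and> k = j + 1 \<or> i = j + 1 \<and> k = j" by auto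
        then show ?thesis
        proof
          assume h: "i = j \<and> k = j + 1"
          have c: "a j \<in> carrier G" "a (j + 1) \<in> carrier G" using closed s by auto
          have "a j \<otimes> a (j + 1) = a j \<otimes> (b j \<otimes> a j)" using b_mult s by simp
          also have "\<dots> = (a j \<otimes> b j) \<otimes> a j" using c b_closed s by (simp add: m_assoc)
          also have "a j \<otimes> b j = a (j + 1)" using rst r s t h by simp
          finally show ?thesis using not_commute s by simp
        next
          assume h: "i = j + 1 \<and> k = j"
          have c: "a j \<in> carrier G" "a (j + 1) \<in> carrier G" using closed s by auto
          have "a (j + 1) \<otimes> a (j + 1) = a (j + 1) \<otimes> (b j \<otimes> a j)" using b_mult s by simp
          also have "\<dots> = (a (j + 1) \<otimes> b j) \<otimes> a j" using c b_closed s by (simp add: m_assoc)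
          also have "a (j + 1) \<otimes> b j = a j" using rst r s t h by simp
          finally show ?thesis using generic[of j] s by (simp add: generic_pair_def)
        qed
      next
        case t: (b k)
        have "i = k \<or> k = j \<or> k = j + 1" "i = k + 1 \<or> k + 1 = j \<or> k = j"
          "i = j \<or> j = k \<or> j = k + 1" "i = j + 1 \<or> j + 1 = k \<or> j = k"
          using el(1)[of k] el(1)[of "k + 1"] el(2)[of j] el(2)[of "j + 1"] r s t
          by (auto simp: a_in_H_iff b_in_H_iff)
        \<comment> \<open>If the index pairs of \<open>b j\<close> and \<open>b k\<close> differed,
          each would have an index missing from the other, and the single index of
          \<open>a i\<close> cannot match both.\<close>
        then have "j = k" by presburger
        then show ?thesis using neq s t by simp
      qed
    qed
  next
    case r: (b i)
    from s show ?thesis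
    proof (cases rule: S_cases)
      case s: (a j)
      from t show ?thesis
      proof (cases rule: S_cases)
        case t: (a k)
        have "j = i \<or> k = i" "j = i + 1 \<or> k = i + 1"
          using el(3)[of i] el(3)[of "i + 1"] r s t by (auto simp: a_in_H_iff b_in_H_iff)
        then have "j = i \<and> k = i + 1 \<or> j = i + 1 \<and> k = i" by auto
        then show ?thesis
        proof
          \<comment> \<open>This is the one family of relations that does occur.\<close>
          assume "j = i \<and> k = i + 1"
          then show ?thesis using r s t rst by auto
        next
          assume h: "j = i + 1 \<and> k = i"
          have c: "a i \<in> carrier G" using closed r by auto
          have "(b i \<otimes> b i) \<otimes> a i = b i \<otimes> (b i \<otimes> a i)" using r c b_closed by (simp add: m_assoc)
          also have "\<dots> = a i" using b_mult rst r s t h by simp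
          finally have "b i \<otimes> b i = \<one>" using c b_closed r by simp
          then show ?thesis using b_square r by simp
        qed
      next
        case t: (b k)
        have "j = k \<or> k = i \<or> k = i + 1" "j = k + 1 \<or> k + 1 = i \<or> k = i"
          "j = i \<or> i = k \<or> i = k + 1" "j = i + 1 \<or> i + 1 = k \<or> i = k"
          using el(1)[of k] el(1)[of "k + 1"] el(3)[of i] el(3)[of "i + 1"] r s t
          by (auto simp: a_in_H_iff b_in_H_iff)
        then have "i = k" by presburger
        then show ?thesis using neq r t by simp
      qed
    next
      case s: (b j)
      from t show ?thesis
      proof (cases rule: S_cases)
        case t: (a k)
        have "k = j \<or> j = i \<or> j = i + 1" "k = j + 1 \<or> j + 1 = i \<or> j = i"
          "k = i \<or> i = j \<or> i = j + 1" "k = i + 1 \<or> i + 1 = j \<or> i = j"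
          using el(2)[of j] el(2)[of "j + 1"] el(3)[of i] el(3)[of "i + 1"] r s t
          by (auto simp: a_in_H_iff b_in_H_iff)
        then have ij: "i = j" by presburger
        then have k: "k = i \<or> k = i + 1"
          using el(1)[of k] r s t by (auto simp: a_in_H_iff b_in_H_iff)
        have c: "a i \<in> carrier G" "a (i + 1) \<in> carrier G" "b i \<in> carrier G"
          using closed b_closed r by auto
        have bb: "b i \<otimes> b i = a k" using rst r s t ij by simp
        \<comment> \<open>\<open>b i\<close> commutes with its own square \<open>a k\<close>. For
          either value of \<open>k\<close>, \<open>b i a i = a (i + 1)\<close> then makes
          \<open>a i\<close> and \<open>a (i + 1)\<close> commute.\<close>
        have comm: "b i \<otimes> a k = a k \<otimes> b i" using c by (simp add: bb[symmetric] m_assoc)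
        have "a i \<otimes> a (i + 1) = a (i + 1) \<otimes> a i"
          using k
        proof
          assume "k = i"
          then have "(b i \<otimes> a i) \<otimes> a i = (a i \<otimes> b i) \<otimes> a i" using comm by simp
          also have "\<dots> = a i \<otimes> (b i \<otimes> a i)" using c by (simp add: m_assoc)
          finally have "a i \<otimes> (b i \<otimes> a i) = (b i \<otimes> a i) \<otimes> a i" by (rule sym)
          then show ?thesis using b_mult r by simp
        next
          assume k: "k = i + 1"
          have "b i \<otimes> (a i \<otimes> a (i + 1)) = b i \<otimes> a i \<otimes> a (i + 1)" using c by (simp add: m_assoc)
          also have "\<dots> = a (i + 1) \<otimes> (b i \<otimes> a i)" using b_mult r by simp
          also have "\<dots> = b i \<otimes> (a (i + 1) \<otimes> a i)" using comm k c by (simp add: m_assoc[symmetric])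
          finally show ?thesis using c by simp
        qed
        then show ?thesis using not_commute r by simp
      next
        case t: (b k)
        have "k = i \<or> k = i + 1 \<or> k = j \<or> k = j + 1" "k + 1 = i \<or> k = i \<or> k + 1 = j \<or> k = j"
          "i = j \<or> i = j + 1 \<or> i = k \<or> i = k + 1" "j = i \<or> j = i + 1 \<or> j = k \<or> j = k + 1"
          using el(1)[of k] el(1)[of "k + 1"] el(2)[of j] el(3)[of i] r s t
          by (auto simp: b_in_H_iff)
        \<comment> \<open>Otherwise \<open>k\<close> and \<open>k + 1\<close> would have to be
          matched by different factors, so that \<open>i\<close> and \<open>j\<close> are
          \<open>k - 1\<close> and \<open>k + 1\<close> in some order; then \<open>k - 1\<close>
          occurs only once.\<close>
        then have "i = k \<or> j = k" by presburger
        then show ?thesis using neq r s t by auto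
      qed
    qed
  qed
qed

section \<open>Rigidity of the Cayley digraph\<close>

lemma arc_S_iff:
  assumes "s \<in> S" "t \<in> S"
  shows "t \<otimes> inv s \<in> S \<longleftrightarrow> (\<exists>i\<in>{1..<d}. s = a i \<and> t = a (i + 1))"
proof
  assume "t \<otimes> inv s \<in> S"
  moreover have "(t \<otimes> inv s) \<otimes> s = t" using assms S_closed by (simp add: m_assoc)
  ultimately show "\<exists>i\<in>{1..<d}. s = a i \<and> t = a (i + 1)"
    using mult_S_in_S[of "t \<otimes> inv s" s] assms by simp
next
  assume "\<exists>i\<in>{1..<d}. s = a i \<and> t = a (i + 1)"
  then obtain i where "i \<in> {1..<d}" "s = a i" "t = a (i + 1)" by blast
  moreover from this have "t \<otimes> inv s = b i" by (simp add: b_def)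
  ultimately show "t \<otimes> inv s \<in> S" by (auto simp: S_def)
qed

lemma a_inj:
  assumes "i \<in> {1..d}" "j \<in> {1..d}" "a i = a j"
  shows "i = j"
  using assms a_in_H_iff by metis

text \<open>Arcs inside \<open>S\<close> join only consecutive \<open>a j\<close>, so the path is
  carried to itself by a shift, and a path on \<open>d\<close> vertices leaves no room for a nonzero
  shift.\<close>

lemma path_rigid:
  assumes maps: "\<And>s. s \<in> S \<Longrightarrow> f s \<in> S"
    and arcs: "\<And>s t. s \<in> S \<Longrightarrow> t \<in> S \<Longrightarrow> f t \<otimes> inv (f s) \<in> S \<longleftrightarrow> t \<otimes> inv s \<in> S"
    and i: "i \<in> {1..d}"
  shows "f (a i) = a i"
proof -
  have aS: "a j \<in> S" if "j \<in> {1..d}" for j using that by (simp add: S_def)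
  have step: "\<exists>m\<in>{1..<d}. f (a j) = a m \<and> f (a (j + 1)) = a (m + 1)" if "j \<in> {1..<d}" for j
    using that arcs[of "a j" "a (j + 1)"] aS maps arc_S_iff by auto
  \<comment> \<open>For \<open>d = 1\<close> there is no arc to follow, but then \<open>S\<close> is
    just \<open>{a 1}\<close>.\<close>
  obtain n where n: "n \<in> {1..d}" "f (a 1) = a n"
  proof (cases "d = 1")
    case True
    then show thesis using that[of 1] maps[of "a 1"] aS[of 1] unfolding S_def by auto
  next
    case False
    then obtain m where "m \<in> {1..<d}" "f (a 1) = a m" using step[of 1] i by auto
    then show thesis using that[of m] by simp
  qed
  \<comment> \<open>The bound keeps the shifted index within \<open>{1..d}\<close>; at
    \<open>j = d\<close> it gives \<open>n = 1\<close>.\<close>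
  have shift: "j + n \<le> d + 1 \<and> f (a j) = a (j + n - 1)" if "j \<in> {1..d}" for j
    using that
  proof (induction j)
    case (Suc j)
    show ?case
    proof (cases "j = 0")
      case True
      then show ?thesis using n by auto
    next
      case False
      then have IH: "j + n \<le> d + 1" "f (a j) = a (j + n - 1)" and j: "j \<in> {1..<d}"
        using Suc by auto
      obtain m where m: "m \<in> {1..<d}" "f (a j) = a m" "f (a (j + 1)) = a (m + 1)"
        using step[OF j] by blast
      have "m = j + n - 1"
        by (rule a_inj) (use m IH j n in auto)
      then show ?thesis using m j n by auto
    qed
  qed simp
  have "n = 1" using shift[of d] i n by auto
  then show ?thesis using shift[OF i] by simp
qed

text \<open>Right translations move \<open>v\<close> and \<open>f v\<close> to the identity, which
  turns \<open>f\<close> into a map \<open>?g\<close> on the out-neighbours of the identity, that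
  is, on \<open>S\<close>. It preserves arcs, so \<open>path_rigid\<close> applies.\<close>

lemma automorphism_commutes:
  assumes f: "f \<in> digraph_automorphisms (cayley_digraph G S)"
    and i: "i \<in> {1..d}" and v: "v \<in> carrier G"
  shows "f (a i \<otimes> v) = a i \<otimes> f v"
proof -
  have fc: "f x \<in> carrier G" if "x \<in> carrier G" for x
    using f that Bij_imp_funcset[of f "carrier G"]
    by (auto simp: digraph_automorphisms_def cayley_digraph_def)
  have farc: "f y \<otimes> inv f x \<in> S \<longleftrightarrow> y \<otimes> inv x \<in> S" if "x \<in> carrier G" "y \<in> carrier G" for x y
    using f that fc by (simp add: digraph_automorphisms_def cayley_digraph_def)
  let ?g = "\<lambda>s. f (s \<otimes> v) \<otimes> inv (f v)"
  have ratio: "(t \<otimes> w) \<otimes> inv (s \<otimes> w) = t \<otimes> inv s"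
    if "s \<in> carrier G" "t \<in> carrier G" "w \<in> carrier G" for s t w
    using that by (simp add: inv_mult_group m_assoc inv_mult_cancel)
  have "?g (a i) = a i"
  proof (rule path_rigid[OF _ _ i])
    fix s assume s: "s \<in> S"
    then show "?g s \<in> S" using farc[of v "s \<otimes> v"] v S_closed by (simp add: m_assoc)
  next
    fix s t assume s: "s \<in> S" and t: "t \<in> S"
    have "?g t \<otimes> inv (?g s) = f (t \<otimes> v) \<otimes> inv (f (s \<otimes> v))"
      using s t v S_closed fc by (intro ratio) auto
    then show "?g t \<otimes> inv (?g s) \<in> S \<longleftrightarrow> t \<otimes> inv s \<in> S"
      using farc[of "s \<otimes> v" "t \<otimes> v"] ratio[of s t v] s t v S_closed by simp
  qed
  moreover have "f (a i \<otimes> v) \<in> carrier G" "f v \<in> carrier G" using fc closed[OF i] v by auto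
  ultimately show ?thesis using closed[OF i] by (metis inv_solve_right)
qed

lemma admits_ORR: "admits_ORR G"
  unfolding admits_ORR_def
proof (intro exI conjI)
  show "S \<subseteq> carrier G" using S_closed by blast
  show "S \<inter> set_inv S = {}"
    using mult_S_neq_one S_closed by (fastforce simp: SET_INV_def)
  show "digraph_automorphisms (cayley_digraph G S) = right_regular_representation G"
  proof (intro equalityI subsetI)
    fix f assume f: "f \<in> digraph_automorphisms (cayley_digraph G S)"
    then have ext: "f \<in> extensional (carrier G)" and bij: "bij_betw f (carrier G) (carrier G)"
      by (auto simp: digraph_automorphisms_def cayley_digraph_def Bij_def)
    have fc: "f x \<in> carrier G" if "x \<in> carrier G" for x
      using that bij by (auto simp: bij_betw_def)
    \<comment> \<open>Commuting with left multiplication by generators extends to all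
      \<open>w\<close>. Taking \<open>v\<close> to be the identity then shows that \<open>f\<close>
      is right multiplication by the image of the identity.\<close>
    have comm: "f (w \<otimes> v) = w \<otimes> f v" if "w \<in> generate G (a ` {1..d})" "v \<in> carrier G" for w v
      using that
    proof (induction arbitrary: v rule: generate.induct)
      case one
      then show ?case by (simp add: fc)
    next
      case (incl h)
      then show ?case using automorphism_commutes[OF f] by auto
    next
      case (inv h)
      then obtain i where i: "i \<in> {1..d}" "h = a i" by blast
      have h: "h \<in> carrier G" using i closed by simp
      have "f v = f (h \<otimes> (inv h \<otimes> v))" using h inv by (simp add: inv_mult_cancel)
      also have "\<dots> = h \<otimes> f (inv h \<otimes> v)" using automorphism_commutes[OF f i(1)] i h inv by simp
      finally show ?case using h inv by (simp add: inv_mult_cancel fc)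
    next
      case (eng h1 h2)
      then have "h1 \<in> carrier G" "h2 \<in> carrier G" using generates by auto
      then show ?case using eng fc by (simp add: m_assoc)
    qed
    have "f = (\<lambda>x\<in>carrier G. x \<otimes> f \<one>)"
    proof (rule extensionalityI[OF ext restrict_extensional])
      fix x assume x: "x \<in> carrier G"
      then show "f x = (\<lambda>x\<in>carrier G. x \<otimes> f \<one>) x" using comm[of x \<one>] generates by simp
    qed
    then show "f \<in> right_regular_representation G"
      unfolding right_regular_representation_def using fc[of \<one>] by blast
  next
    fix f assume "f \<in> right_regular_representation G"
    then obtain g where g: "g \<in> carrier G" and f: "f = (\<lambda>x\<in>carrier G. x \<otimes> g)"
      by (auto simp: right_regular_representation_def)
    have "bij_betw f (carrier G) (carrier G)"
      by (rule bij_betw_byWitness[where f' = "\<lambda>x. x \<otimes> inv g"]) (use g f in \<open>auto simp: m_assoc\<close>)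
    moreover have "(y \<otimes> g) \<otimes> inv (x \<otimes> g) = y \<otimes> inv x" if "x \<in> carrier G" "y \<in> carrier G" for x y
      using that g by (simp add: inv_mult_group m_assoc inv_mult_cancel)
    ultimately show "f \<in> digraph_automorphisms (cayley_digraph G S)"
      using g f by (auto simp: digraph_automorphisms_def cayley_digraph_def Bij_def)
  qed
qed

end

section \<open>Minimal generating tuples and the conclusion\<close>

text \<open>Comparing \<open>d\<close> with arbitrary generating sets makes minimality independent
  of the tuple found here, so it remains available once the entries have been replaced.\<close>

lemma (in group) exists_minimal_generating_tuple:
  assumes fin: "finite (carrier G)"
  obtains a :: "nat \<Rightarrow> 'a" and d where "a ` {1..d} \<subseteq> carrier G" "generate G (a ` {1..d}) = carrier G"
    and "\<And>Y. Y \<subseteq> carrier G \<Longrightarrow> generate G Y = carrier G \<Longrightarrow> d \<le> card Y"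
proof -
  let ?P = "\<lambda>n. \<exists>a :: nat \<Rightarrow> 'a. a ` {1..n} \<subseteq> carrier G \<and> generate G (a ` {1..n}) = carrier G"
  have P: "?P (card Y)" if Y: "Y \<subseteq> carrier G" "generate G Y = carrier G" for Y
  proof -
    obtain a where "bij_betw a {1..card Y} Y"
      using ex_bij_betw_nat_finite_1[of Y] fin finite_subset Y(1) by blast
    then have "a ` {1..card Y} = Y" by (simp add: bij_betw_def)
    then show ?thesis using Y by (intro exI[of _ a]) simp
  qed
  have "generate G (carrier G) = carrier G"
    using generate_incl[of "carrier G"] generate.incl[of _ "carrier G" G] by blast
  then have "?P (card (carrier G))" using P by blast
  then have "?P (LEAST n. ?P n)" by (rule LeastI)
  then obtain a where a: "a ` {1..LEAST n. ?P n} \<subseteq> carrier G"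
    "generate G (a ` {1..LEAST n. ?P n}) = carrier G"
    by blast
  then show thesis
    by (rule that) (rule Least_le[of ?P, OF P])
qed

lemma (in group) ord_gt_two:
  assumes "finite (carrier G)" and x: "x \<in> carrier G" and sq: "x \<otimes> x \<noteq> \<one>"
  shows "ord x > 2"
proof -
  have "ord x \<ge> 1" using ord_ge_1[OF assms(1,2)] .
  moreover have "ord x \<noteq> 1" using ord_eq_1[OF x] sq by auto
  moreover have "ord x \<noteq> 2"
  proof
    assume "ord x = 2"
    then have "x [^] (2::nat) = \<one>" using pow_ord_eq_1[OF x] by simp
    then show False using sq x by (simp add: numeral_2_eq_2)
  qed
  ultimately show ?thesis by linarith
qed

theorem theorem6p2:
  fixes G :: "('a, 'b) monoid_scheme" (structure)
  assumes "group G" and "finite (carrier G)" and "\<not> solvable G"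
  shows "(\<exists>(d::nat) (a :: nat \<Rightarrow> 'a).
            inj_on a {1..d} \<and>
            irredundant_generating_set G (a ` {1..d}) \<and>
            (\<forall>i\<in>{1..d}. group.ord G (a i) > 2) \<and>
            (\<forall>i\<in>{1..<d}. group.ord G (a (i + 1) \<otimes> inv (a i)) > 2))
         \<and> admits_ORR G"
proof -
  interpret group G by (rule assms(1))
  obtain c d where c: "c ` {1..d} \<subseteq> carrier G" "generate G (c ` {1..d}) = carrier G"
    and min: "\<And>Y. Y \<subseteq> carrier G \<Longrightarrow> generate G Y = carrier G \<Longrightarrow> d \<le> card Y"
    using exists_minimal_generating_tuple[OF assms(2)] by blast
  obtain a where a: "a ` {1..d} \<subseteq> carrier G" "generate G (a ` {1..d}) = carrier G"
    and sq: "\<And>i. i \<in> {1..d} \<Longrightarrow> a i \<otimes> a i \<noteq> \<one>"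
    and gp: "\<And>i. i \<in> {1..<d} \<Longrightarrow> generic_pair (a i) (a (i + 1))"
    using exists_generic_tuple[OF assms(2,3) c] by blast
  have ac: "a i \<in> carrier G" if "i \<in> {1..d}" for i using that a(1) by blast
  \<comment> \<open>The improved tuple still has length \<open>d\<close>, so a repeated entry would
    give a generating set that is too small.\<close>
  have card: "card (a ` {1..d}) = d"
    using min[OF a] card_image_le[of "{1..d}" a] by simp
  then have inj: "inj_on a {1..d}" by (intro eq_card_imp_inj_on) auto
  have irr: "generate G (a ` {1..d} - {s}) \<noteq> carrier G" if s: "s \<in> a ` {1..d}" for s
  proof
    assume "generate G (a ` {1..d} - {s}) = carrier G"
    then have "d \<le> card (a ` {1..d} - {s})" using min a(1) by blast
    moreover have "card (a ` {1..d} - {s}) < card (a ` {1..d})"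
      using s by (intro card_Diff1_less) auto
    ultimately show False using card by simp
  qed
  \<comment> \<open>By injectivity, deleting an index is the same as deleting an element, which
    links the locale's form of irredundancy to \<open>irr\<close>.\<close>
  have "a i \<notin> generate G (a ` ({1..d} - {i}))" if i: "i \<in> {1..d}" for i
  proof
    assume ai: "a i \<in> generate G (a ` ({1..d} - {i}))"
    have eq: "a ` ({1..d} - {i}) = a ` {1..d} - {a i}"
      using inj_on_image_set_diff[OF inj, of "{1..d}" "{i}"] i by simp
    have sub: "a ` ({1..d} - {i}) \<subseteq> carrier G" using a(1) by blast
    have "a ` {1..d} \<subseteq> generate G (a ` ({1..d} - {i}))"
      using ai by (auto intro: generate.incl)
    then have "carrier G \<subseteq> generate G (a ` ({1..d} - {i}))"
      using generate_subgroup_incl[OF _ generate_is_subgroup[OF sub]] a(2) by blast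
    then show False using irr[of "a i"] generate_incl[OF sub] i eq by auto
  qed
  then interpret generic_generating_tuple G a d
    using ac a(2) sq gp by unfold_locales
  have "irredundant_generating_set G (a ` {1..d})"
    using a irr by (simp add: irredundant_generating_set_def)
  moreover have "\<forall>i\<in>{1..d}. ord (a i) > 2"
    using ord_gt_two[OF assms(2)] ac sq by blast
  moreover have "\<forall>i\<in>{1..<d}. ord (a (i + 1) \<otimes> inv (a i)) > 2"
    using ord_gt_two[OF assms(2)] b_closed b_square by (simp add: b_def)
  ultimately show ?thesis using inj admits_ORR by blast
qed

end
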